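(* Let $\mu(dx):=e^{-x}(I_0(x)-I_1(x))\,1_{(0,\infty)}(x)\,dx$. Then $\mu$ is a probability measure and $$ \int_0^\infty(e^{itx}-1)\,\mu(dx) =\frac{it}{\sqrt{-t(t+2i)}}, \qquad t\in \mathbb{R}, $$ where the right-hand side at $t=0$ is read as its limit $0$. Both the right-hand and the left-hand expressions, as functions of $t$, are logarithms of infinitely divisible characteristic functions (of compound Poisson distributions).
   Context: $I_\nu$ denotes the modified Bessel function of the first kind of order $\nu$; $\sqrt{\cdot}$ is the principal branch of the complex square root (note $-t(t+2i)=(1-it)^2-1$). (The identity is associated with the selfdecomposable Feller–Spitzer, or Bessel, characteristic function $[1-it-\sqrt{(1-it)^2-1}]^{\nu}$.) *)

theory Defs
  imports "HOL-Analysis.Analysis" "HOL-Probability.Probability"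
begin

text \<open>
  Modified Bessel function of the first kind of real order, for a positive argument. (At \<open>x = 0\<close>
  the convention \<open>0 powr a = 0\<close> would give the wrong value for \<open>I\<^sub>0\<close>; that point is never used.)
  At poles of \<open>Gamma\<close> the conventions \<open>Gamma = 0\<close> and \<open>c / 0 = 0\<close> give the usual vanishing terms.
\<close>

definition bessel_I :: "real \<Rightarrow> real \<Rightarrow> real" where
  "bessel_I \<nu> x = (\<Sum>k. (x / 2) powr (\<nu> + 2 * real k) / (fact k * Gamma (\<nu> + real k + 1)))"

lemma bessel_I_of_nat:
  assumes "x > 0"
  shows "bessel_I (real n) x = (\<Sum>k. (x / 2) ^ (n + 2 * k) / (fact k * fact (n + k)))"
proof -
  have "(x / 2) powr (real n + 2 * real k) = (x / 2) ^ (n + 2 * k)" for k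
    using assms powr_realpow[of "x / 2" "n + 2 * k"] by simp
  moreover have "Gamma (real n + real k + 1) = fact (n + k)" for k
    using Gamma_fact[of "n + k", where 'a = real] by (simp add: add_ac)
  ultimately show ?thesis
    unfolding bessel_I_def by simp
qed

text \<open>
  \<open>ennreal\<close> truncates negative reals to 0, so this is the measure with the displayed density only
  together with \<open>I\<^sub>0 \<ge> I\<^sub>1\<close> on the positive half-line.
\<close>

definition bessel_measure :: "real measure" where
  "bessel_measure =
     density lborel (\<lambda>x. ennreal (exp (- x) * (bessel_I 0 x - bessel_I 1 x) * indicator {0<..} x))"

definition bessel_exponent :: "real \<Rightarrow> complex" where
  "bessel_exponent t =
     (if t = 0 then 0
      else \<i> * of_real t / csqrt (- (of_real t) * (of_real t + 2 * \<i>)))"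

primrec convolution_power :: "real measure \<Rightarrow> nat \<Rightarrow> real measure" where
  "convolution_power M 0 = return borel 0"
| "convolution_power M (Suc n) = convolution M (convolution_power M n)"

definition infinitely_divisible :: "real measure \<Rightarrow> bool" where
  "infinitely_divisible M \<longleftrightarrow>
     real_distribution M \<and>
     (\<forall>n\<ge>1. \<exists>N. real_distribution N \<and> convolution_power N n = M)"

text \<open>
  The law of \<open>X\<^sub>1 + \<dots> + X\<^sub>N\<close>, where \<open>N\<close> is Poisson with parameter \<open>r\<close> and the \<open>X\<^sub>i\<close> are
  independent with law \<open>S\<close>, i.e. \<open>exp (- r) \<Sum>\<^sub>n r ^ n / n! S\<^sup>*\<^sup>n\<close>.
\<close>

definition compound_poisson :: "real \<Rightarrow> real measure \<Rightarrow> real measure" where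
  "compound_poisson r S = bind (measure_pmf (poisson_pmf r)) (convolution_power S)"

text \<open>
  The jump law is required to have no atom at 0; this only excludes the degenerate law at 0.
\<close>

definition is_compound_poisson :: "real measure \<Rightarrow> bool" where
  "is_compound_poisson M \<longleftrightarrow>
     (\<exists>r S. r > 0 \<and> real_distribution S \<and> measure S {0} = 0 \<and> M = compound_poisson r S)"

text \<open>
  The logarithm of a characteristic function is the distinguished one: continuous and vanishing
  at 0. It need not be the principal branch \<open>Ln\<close> of the values.
\<close>

definition is_log_char :: "(real \<Rightarrow> complex) \<Rightarrow> real measure \<Rightarrow> bool" where
  "is_log_char f M \<longleftrightarrow>
     continuous_on UNIV f \<and> f 0 = 0 \<and> (\<forall>t. exp (f t) = char M t)"

end

theory Submission
  imports Defs
begin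

text \<open>
  The law \<open>\<mu>\<close> is a mixture of exponential laws. Expanding the exponential and integrating the powers
  of the cosine gives the classical integrals
  \<open>I\<^sub>0(x) = (1/\<pi>) \<integral>\<^sub>0\<^sup>\<pi> exp (x cos \<theta>) d\<theta>\<close> and \<open>I\<^sub>1(x) = (1/\<pi>) \<integral>\<^sub>0\<^sup>\<pi> exp (x cos \<theta>) cos \<theta> d\<theta>\<close>,
  so the density of \<open>\<mu>\<close> at \<open>x > 0\<close> is
  \<open>(1/\<pi>) \<integral>\<^sub>0\<^sup>\<pi> c(\<theta>) exp (- c(\<theta>) x) d\<theta>\<close> with \<open>c(\<theta>) = 1 - cos \<theta>\<close>
  (\<open>bessel_density_eq_mixture\<close>). Positivity and total mass 1 can be read off, and by Fubini the
  characteristic function of \<open>\<mu>\<close> at \<open>t\<close> is the average of \<open>c(\<theta>) / (c(\<theta>) - it)\<close>, that is,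
  1 plus \<open>it\<close> times the average of \<open>1 / (s - cos \<theta>)\<close> with \<open>s = 1 - it\<close>.

  The latter average is \<open>1 / \<surd>(s\<^sup>2 - 1)\<close> (\<open>average_inverse_minus_cos\<close>). To see this, put
  \<open>w = \<surd>(s\<^sup>2 - 1)\<close> and \<open>\<rho> = s - w\<close>; then \<open>w / (s - cos \<theta>)\<close> is the Poisson kernel
  \<open>(1 - \<rho>\<^sup>2) / (1 - 2 \<rho> cos \<theta> + \<rho>\<^sup>2)\<close>, whose average is 1 as soon as \<open>|\<rho>| < 1\<close>. The principal branch
  of the root is the one that makes \<open>\<rho>\<close> the small root of \<open>\<rho>\<^sup>2 - 2 s \<rho> + 1 = 0\<close>
  (\<open>csqrt_bessel_branch\<close>).

  Hence the exponent is \<open>\<phi> - 1\<close> with \<open>\<phi>\<close> the characteristic function of \<open>\<mu>\<close>. The exponent is therefore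
  continuous and vanishes at 0, and \<open>exp (\<phi> - 1)\<close> is the characteristic function of the compound Poisson law of
  rate 1 and jump law \<open>\<mu>\<close> (\<open>char_compound_poisson\<close>). Compound Poisson laws are infinitely divisible,
  since dividing the rate by \<open>n\<close> gives an \<open>n\<close>-th convolution root.
\<close>

section \<open>Convolution powers and compound Poisson laws\<close>

lemma real_distribution_convolution:
  assumes "real_distribution M" "real_distribution N"
  shows "real_distribution (convolution M N)"
proof -
  interpret M: real_distribution M by fact
  interpret N: real_distribution N by fact
  interpret P: pair_prob_space M N ..
  have "prob_space (convolution M N)"
    unfolding convolution_def by (rule P.prob_space_distr) measurable
  then show ?thesis
    by (intro real_distribution.intro real_distribution_axioms.intro) simp_all
qed

lemma char_convolution:
  assumes "real_distribution M" "real_distribution N"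
  shows "char (convolution M N) t = char M t * char N t"
proof -
  interpret M: real_distribution M by fact
  interpret N: real_distribution N by fact
  interpret P: pair_prob_space M N ..
  have int: "integrable (M \<Otimes>\<^sub>M N) (\<lambda>p. iexp (t * (fst p + snd p)))"
    by (intro P.integrable_iexp) auto
  have "char (convolution M N) t = (\<integral>p. iexp (t * (fst p + snd p)) \<partial>(M \<Otimes>\<^sub>M N))"
    unfolding char_def convolution_def by (subst integral_distr) (auto simp: case_prod_beta)
  also have "\<dots> = (\<integral>x. \<integral>y. iexp (t * (x + y)) \<partial>N \<partial>M)"
    using P.integral_fst'[OF int] by simp
  also have "\<dots> = (\<integral>x. \<integral>y. iexp (t * x) * iexp (t * y) \<partial>N \<partial>M)"
    by (simp add: exp_add [symmetric] algebra_simps)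
  also have "\<dots> = char M t * char N t"
    by (simp add: char_def)
  finally show ?thesis .
qed

lemma real_distribution_convolution_power:
  assumes "real_distribution M"
  shows "real_distribution (convolution_power M n)"
proof (induction n)
  case 0
  have "prob_space (return borel (0::real))"
    by (rule prob_space_return) simp
  then show ?case
    by (simp add: real_distribution_def real_distribution_axioms_def)
qed (simp add: real_distribution_convolution assms)

lemma char_convolution_power:
  assumes "real_distribution M"
  shows "char (convolution_power M n) t = char M t ^ n"
proof (induction n)
  case 0
  then show ?case by (simp add: char_def integral_return)
next
  case (Suc n)
  then show ?case
    by (simp add: char_convolution assms real_distribution_convolution_power)
qed

lemma integral_poisson_pmf:
  fixes f :: "nat \<Rightarrow> complex"
  assumes r: "0 < r" and bound: "\<And>n. norm (f n) \<le> 1"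
  shows "(\<integral>n. f n \<partial>measure_pmf (poisson_pmf r)) = (\<Sum>n. (r ^ n / fact n * exp (- r)) *\<^sub>R f n)"
proof -
  have "integrable (measure_pmf (poisson_pmf r)) f"
    by (rule measure_pmf.integrable_const_bound[of _ 1]) (use bound in auto)
  then have "integrable (count_space UNIV) (\<lambda>n. pmf (poisson_pmf r) n *\<^sub>R f n)"
    unfolding measure_pmf_eq_density by (subst (asm) integrable_density) auto
  then have "(\<integral>n. pmf (poisson_pmf r) n *\<^sub>R f n \<partial>count_space UNIV)
      = (\<Sum>n. pmf (poisson_pmf r) n *\<^sub>R f n)"
    by (rule integral_count_space_nat)
  then show ?thesis
    unfolding measure_pmf_eq_density by (subst integral_density) (auto simp: r less_imp_le)
qed

context
  fixes S :: "real measure"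
  assumes S: "real_distribution S"
begin

lemma convolution_power_measurable:
  "convolution_power S \<in> measure_pmf p \<rightarrow>\<^sub>M subprob_algebra borel"
proof -
  interpret P: real_distribution "convolution_power S n" for n
    by (rule real_distribution_convolution_power[OF S])
  show ?thesis
    by (auto simp: measurable_def space_subprob_algebra P.subprob_space_axioms)
qed

lemma real_distribution_compound_poisson: "real_distribution (compound_poisson r S)"
proof -
  interpret P: real_distribution "convolution_power S n" for n
    by (rule real_distribution_convolution_power[OF S])
  have "prob_space (compound_poisson r S)"
    unfolding compound_poisson_def
    by (rule measure_pmf.prob_space_bind[OF _ convolution_power_measurable])
      (auto simp: P.prob_space_axioms)
  moreover have "sets (compound_poisson r S) = sets borel"
    unfolding compound_poisson_def by (rule sets_bind) auto
  ultimately show ?thesis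
    by (simp add: real_distribution_def real_distribution_axioms_def)
qed

lemma integral_compound_poisson:
  fixes g :: "real \<Rightarrow> real"
  assumes "g \<in> borel_measurable borel" "\<And>x. \<bar>g x\<bar> \<le> 1"
  shows "(\<integral>x. g x \<partial>compound_poisson r S)
    = (\<integral>n. (\<integral>x. g x \<partial>convolution_power S n) \<partial>measure_pmf (poisson_pmf r))"
proof -
  interpret P: real_distribution "convolution_power S n" for n
    by (rule real_distribution_convolution_power[OF S])
  show ?thesis
    unfolding compound_poisson_def
    by (rule integral_bind[where K = borel and B = 1 and B' = 1,
          OF _ _ convolution_power_measurable measure_pmf.finite_measure_axioms])
      (use assms P.emeasure_space_1 in auto)
qed

text \<open>
  Conditioning on the number of jumps turns the characteristic function into the probability
  generating function of the Poisson law, \<open>z \<mapsto> exp (r (z - 1))\<close>, at the characteristic function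
  of the jumps.
\<close>

lemma char_compound_poisson:
  assumes r: "0 < r"
  shows "char (compound_poisson r S) t = exp (of_real r * (char S t - 1))"
proof -
  interpret S: real_distribution S by (rule S)
  interpret P: real_distribution "convolution_power S n" for n
    by (rule real_distribution_convolution_power[OF S])
  interpret C: real_distribution "compound_poisson r S"
    by (rule real_distribution_compound_poisson)
  have bnd: "norm (char S t ^ n) \<le> 1" for n
    by (simp add: norm_power power_le_one S.cmod_char_le_1)
  have int: "integrable (measure_pmf (poisson_pmf r)) (\<lambda>n. char S t ^ n)"
    by (rule measure_pmf.integrable_const_bound[of _ 1]) (use bnd in auto)
  have iC: "integrable (compound_poisson r S) (\<lambda>x. iexp (t * x))"
    by (rule C.integrable_iexp) auto
  have iP: "integrable (convolution_power S n) (\<lambda>x. iexp (t * x))" for n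
    by (rule P.integrable_iexp) auto
  have iexp_parts: "\<bar>Re (iexp y)\<bar> \<le> 1" "\<bar>Im (iexp y)\<bar> \<le> 1" for y
    using abs_Re_le_cmod[of "iexp y"] abs_Im_le_cmod[of "iexp y"] by simp_all
  have char_power: "(\<integral>x. iexp (t * x) \<partial>convolution_power S n) = char S t ^ n" for n
    using char_convolution_power[OF S, of n t] by (simp add: char_def)
  have "char (compound_poisson r S) t = (\<integral>n. char S t ^ n \<partial>measure_pmf (poisson_pmf r))"
  proof (rule complex_eqI)
    show "Re (char (compound_poisson r S) t) = Re (\<integral>n. char S t ^ n \<partial>measure_pmf (poisson_pmf r))"
      unfolding char_def[of "compound_poisson r S"] integral_Re[OF iC, symmetric]
        integral_Re[OF int, symmetric]
      unfolding char_power[symmetric] integral_Re[OF iP, symmetric]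
      by (rule integral_compound_poisson) (use iexp_parts[of "t * x" for x] in auto)
    show "Im (char (compound_poisson r S) t) = Im (\<integral>n. char S t ^ n \<partial>measure_pmf (poisson_pmf r))"
      unfolding char_def[of "compound_poisson r S"] integral_Im[OF iC, symmetric]
        integral_Im[OF int, symmetric]
      unfolding char_power[symmetric] integral_Im[OF iP, symmetric]
      by (rule integral_compound_poisson) (use iexp_parts[of "t * x" for x] in auto)
  qed
  also have "\<dots> = (\<Sum>n. (r ^ n / fact n * exp (- r)) *\<^sub>R char S t ^ n)"
    by (rule integral_poisson_pmf[OF r bnd])
  also have "\<dots> = (\<Sum>n. exp (- of_real r) * ((of_real r * char S t) ^ n /\<^sub>R fact n))"
    by (intro suminf_cong) (simp add: scaleR_conv_of_real field_simps flip: exp_of_real)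
  also have "\<dots> = exp (- of_real r) * exp (of_real r * char S t)"
    unfolding sums_unique[OF exp_converges[of "of_real r * char S t"]]
    by (rule suminf_mult[OF summable_exp_generic])
  also have "\<dots> = exp (of_real r * (char S t - 1))"
    by (simp add: exp_add [symmetric] algebra_simps)
  finally show ?thesis .
qed

text \<open>
  The root of order \<open>n\<close> is the compound Poisson law of rate \<open>r / n\<close>; its \<open>n\<close>-th convolution power
  is recognised by its characteristic function.
\<close>

lemma infinitely_divisible_compound_poisson:
  assumes r: "0 < r"
  shows "infinitely_divisible (compound_poisson r S)"
  unfolding infinitely_divisible_def
proof (intro conjI allI impI real_distribution_compound_poisson)
  fix n :: nat
  assume n: "1 \<le> n"
  let ?N = "compound_poisson (r / n) S"
  have N: "real_distribution ?N"
    by (rule real_distribution_compound_poisson)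
  have "char (convolution_power ?N n) = char (compound_poisson r S)"
  proof
    fix t
    have "char (convolution_power ?N n) t = exp (of_real (r / n) * (char S t - 1)) ^ n"
      using n r by (simp add: char_convolution_power[OF N] char_compound_poisson)
    also have "\<dots> = exp (of_real r * (char S t - 1))"
      using n by (simp add: exp_of_nat_mult [symmetric])
    finally show "char (convolution_power ?N n) t = char (compound_poisson r S) t"
      by (simp add: char_compound_poisson r)
  qed
  then have "convolution_power ?N n = compound_poisson r S"
    by (intro Levy_uniqueness real_distribution_convolution_power
        real_distribution_compound_poisson N)
  then show "\<exists>N. real_distribution N \<and> convolution_power N n = compound_poisson r S"
    using N by blast
qed

end

section \<open>Mixtures of exponential laws\<close>

text \<open>
  The density of the exponential law of rate \<open>c\<close>, taken to be 0 at the origin, so that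
  mixtures of such densities agree with the Bessel density at every point and not only almost
  everywhere.
\<close>

abbreviation expo_density :: "real \<Rightarrow> real \<Rightarrow> real" where
  "expo_density c x \<equiv> c * exp (- (c * x)) * indicator {0<..} x"

lemma has_bochner_integral_exponential:
  fixes c :: real
  assumes c: "0 < c"
  shows "has_bochner_integral lborel (\<lambda>x. expo_density c x) 1"
proof -
  have "has_bochner_integral lborel (\<lambda>x. exp (- x) * indicator {0<..} x) (1::real)"
    using has_bochner_integral_I0i_power_exp_m[of 0] by simp
  then have "has_bochner_integral lborel (\<lambda>x. exp (- (c * x)) * indicator {0<..} (c * x)) (1 / c)"
    using lborel_has_bochner_integral_real_affine_iff[of c "\<lambda>x. exp (- x) * indicator {0<..} x" 1 0] c
    by (simp add: inverse_eq_divide)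
  then have "has_bochner_integral lborel (\<lambda>x. c * (exp (- (c * x)) * indicator {0<..} (c * x))) (c * (1 / c))"
    by (rule has_bochner_integral_mult_right)
  then show ?thesis
    using c by (simp add: indicator_def zero_less_mult_iff mult.assoc)
qed

text \<open>
  The integrand is \<open>c exp (- (c - it) x)\<close>, with the primitive
  \<open>- c / (c - it) exp (- (c - it) x)\<close>, which tends to 0 at infinity.
\<close>

lemma integral_exponential_iexp:
  fixes c t :: real
  assumes c: "0 < c"
  shows "(\<integral>x. expo_density c x *\<^sub>R iexp (t * x) \<partial>lborel)
    = of_real c / (of_real c - \<i> * of_real t)"
proof -
  define z where "z = of_real c - \<i> * of_real t"
  have Re_z: "Re z = c" by (simp add: z_def)
  then have z: "z \<noteq> 0" using c by auto
  let ?f = "\<lambda>x. of_real c * exp (- z * of_real x)"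
  let ?F = "\<lambda>x. - (of_real c / z) * exp (- z * of_real x)"
  have eq: "expo_density c x *\<^sub>R iexp (t * x) = indicator {0<..} x *\<^sub>R ?f x" for x
    by (simp add: z_def indicator_def exp_add [symmetric] exp_of_real scaleR_conv_of_real algebra_simps
        flip: exp_of_real)
  have "integrable lborel (\<lambda>x. expo_density c x *\<^sub>R iexp (t * x))"
    by (rule Bochner_Integration.integrable_bound[OF has_bochner_integral_exponential[OF c, THEN integrable.intros]])
      auto
  then have "integrable lborel (\<lambda>x. indicator {0<..} x *\<^sub>R ?f x)"
    by (simp only: eq)
  then have int: "set_integrable lborel (einterval 0 \<infinity>) ?f"
    by (simp add: set_integrable_def zero_ereal_def)
  have "(LBINT x=0..\<infinity>. ?f x) = 0 - ?F 0"
  proof (rule interval_integral_FTC_integrable[where F = ?F])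
    show "(?F has_vector_derivative ?f x) (at x)" for x
      using z by (auto intro!: derivative_eq_intros has_vector_derivative_real_field
          simp: field_simps)
    show "isCont ?f x" for x
      by (intro continuous_intros)
    show "((?F \<circ> real_of_ereal) \<longlongrightarrow> ?F 0) (at_right 0)"
      unfolding zero_ereal_def ereal_tendsto_simps
      by (rule tendsto_eq_intros tendsto_ident_at refl | simp)+
    have "((\<lambda>x. cmod (of_real c / z) * exp (- c * x)) \<longlongrightarrow> 0) at_top"
      using c by real_asymp
    then have "(?F \<longlongrightarrow> 0) at_top"
      by (subst tendsto_norm_zero_iff[symmetric]) (simp add: norm_mult norm_divide Re_z)
    then show "((?F \<circ> real_of_ereal) \<longlongrightarrow> 0) (at_left \<infinity>)"
      unfolding ereal_tendsto_simps .
  qed (use int in auto)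
  then have "(LBINT x:{0<..}. ?f x) = of_real c / z"
    by (simp add: interval_lebesgue_integral_0_infty)
  then show ?thesis
    by (simp only: set_lebesgue_integral_def eq z_def)
qed

lemma integrable_exponential_kernel:
  fixes c :: "'a \<Rightarrow> real"
  assumes "finite_measure M" and c[measurable]: "c \<in> borel_measurable M"
    and pos: "AE a in M. 0 < c a"
  shows "integrable M (\<lambda>a. expo_density (c a) x)"
proof -
  interpret finite_measure M by fact
  \<comment> \<open>The bound \<open>1 / x\<close> does not depend on the rate, so the rates may be unbounded.\<close>
  have bound: "u * exp (- (u * x)) \<le> 1 / x" if "0 < u" "0 < x" for u
  proof -
    have "u * x \<le> exp (u * x)"
      using exp_ge_add_one_self[of "u * x"] by linarith
    then show ?thesis
      using that by (simp add: exp_minus field_simps)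
  qed
  show ?thesis
  proof (cases "0 < x")
    case True
    then show ?thesis
      by (intro integrable_const_bound[of _ "1 / x"])
        (use pos in \<open>auto elim!: eventually_mono intro: bound\<close>)
  qed simp
qed

text \<open>
  The law with a random rate: draw \<open>a\<close> from \<open>M\<close>, then an exponential variable of rate \<open>c a\<close>. It is
  given by its density, the form in which the Bessel law appears.
\<close>

definition exponential_mixture :: "'a measure \<Rightarrow> ('a \<Rightarrow> real) \<Rightarrow> real measure" where
  "exponential_mixture M c =
     density lborel (\<lambda>x. ennreal (\<integral>a. expo_density (c a) x \<partial>M))"

context
  fixes M :: "'a measure" and c :: "'a \<Rightarrow> real"
  assumes M: "prob_space M" and c[measurable]: "c \<in> borel_measurable M"
    and pos: "AE a in M. 0 < c a"
begin

interpretation M: prob_space M by (rule M)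
interpretation P: pair_sigma_finite M lborel ..

lemma real_distribution_exponential_mixture: "real_distribution (exponential_mixture M c)"
proof -
  have "emeasure (exponential_mixture M c) UNIV = (\<integral>\<^sup>+x. ennreal (\<integral>a. expo_density (c a) x \<partial>M) \<partial>lborel)"
    unfolding exponential_mixture_def by (subst emeasure_density) auto
  also have "\<dots> = (\<integral>\<^sup>+x. \<integral>\<^sup>+a. ennreal (expo_density (c a) x) \<partial>M \<partial>lborel)"
    by (intro nn_integral_cong nn_integral_eq_integral[symmetric]
        integrable_exponential_kernel M.finite_measure_axioms c pos)
      (use pos in \<open>auto elim!: eventually_mono\<close>)
  also have "\<dots> = (\<integral>\<^sup>+a. \<integral>\<^sup>+x. ennreal (expo_density (c a) x) \<partial>lborel \<partial>M)"
    by (rule P.Fubini') measurable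
  also have "\<dots> = (\<integral>\<^sup>+a. 1 \<partial>M)"
  proof (intro nn_integral_cong_AE)
    show "AE a in M. (\<integral>\<^sup>+x. ennreal (expo_density (c a) x) \<partial>lborel) = 1"
      using pos
    proof eventually_elim
      case (elim a)
      then show ?case
        using has_bochner_integral_exponential[of "c a"]
        by (subst nn_integral_eq_integral) (auto simp: has_bochner_integral_iff)
    qed
  qed
  finally have "emeasure (exponential_mixture M c) UNIV = 1"
    by (simp add: M.emeasure_space_1)
  then have "prob_space (exponential_mixture M c)"
    by (intro prob_spaceI) (simp add: exponential_mixture_def)
  then show ?thesis
    by (simp add: real_distribution_def real_distribution_axioms_def exponential_mixture_def)
qed

lemma AE_exponential_mixture_pos: "AE x in exponential_mixture M c. 0 < x"
  unfolding exponential_mixture_def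
  by (subst AE_density) (auto simp: indicator_def)

text \<open>
  The modulus of the integrand is the exponential density, of integral 1 for almost every rate, so
  Fubini applies and the exponential laws are transformed one by one.
\<close>

lemma char_exponential_mixture:
  "char (exponential_mixture M c) t = (\<integral>a. of_real (c a) / (of_real (c a) - \<i> * of_real t) \<partial>M)"
proof -
  have nonneg: "AE x in lborel. 0 \<le> (\<integral>a. expo_density (c a) x \<partial>M)"
    by (rule AE_I2, rule integral_nonneg_AE) (use pos in \<open>auto elim!: eventually_mono\<close>)
  let ?g = "\<lambda>a x. expo_density (c a) x *\<^sub>R iexp (t * x)"
  have int: "integrable (M \<Otimes>\<^sub>M lborel) (case_prod ?g)"
  proof (rule P.Fubini_integrable)
    have "AE a in M. (\<integral>x. norm (?g a x) \<partial>lborel) = 1"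
      using pos
    proof eventually_elim
      case (elim a)
      then show ?case
        using has_bochner_integral_exponential[of "c a"]
        by (simp add: has_bochner_integral_iff abs_mult)
    qed
    then show "integrable M (\<lambda>a. \<integral>x. norm (case (a, x) of (a, x) \<Rightarrow> ?g a x) \<partial>lborel)"
      by (subst integrable_cong_AE[where g = "\<lambda>_. 1"]) auto
    show "AE a in M. integrable lborel (\<lambda>x. case (a, x) of (a, x) \<Rightarrow> ?g a x)"
      using pos
    proof eventually_elim
      case (elim a)
      show ?case
        by (rule Bochner_Integration.integrable_bound
            [OF has_bochner_integral_exponential[OF elim, THEN integrable.intros]]) auto
    qed
  qed measurable
  have "char (exponential_mixture M c) t = (\<integral>x. (\<integral>a. expo_density (c a) x \<partial>M) *\<^sub>R iexp (t * x) \<partial>lborel)"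
    unfolding char_def exponential_mixture_def by (subst integral_density[OF _ _ nonneg]) auto
  also have "\<dots> = (\<integral>x. (\<integral>a. ?g a x \<partial>M) \<partial>lborel)"
    by (intro Bochner_Integration.integral_cong refl integral_scaleR_left[symmetric]
        integrable_exponential_kernel M.finite_measure_axioms c pos)
  also have "\<dots> = (\<integral>a. (\<integral>x. ?g a x \<partial>lborel) \<partial>M)"
    by (rule P.Fubini_integral[OF int])
  also have "\<dots> = (\<integral>a. of_real (c a) / (of_real (c a) - \<i> * of_real t) \<partial>M)"
    by (rule integral_cong_AE)
      (use pos integral_exponential_iexp[of _ t] in \<open>auto elim!: eventually_mono\<close>)
  finally show ?thesis .
qed

end

section \<open>Averages over a uniform angle\<close>

lemma has_bochner_integral_uniform_FTC:
  fixes f F :: "real \<Rightarrow> 'a::euclidean_space"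
  assumes ab: "a < b"
    and F: "\<And>x. a \<le> x \<Longrightarrow> x \<le> b \<Longrightarrow> (F has_vector_derivative f x) (at x within {a..b})"
    and f: "continuous_on UNIV f"
  shows "has_bochner_integral (uniform_measure lborel {a..b}) f ((F b - F a) /\<^sub>R (b - a))"
proof -
  have [measurable]: "f \<in> borel_measurable borel"
    using f by (rule borel_measurable_continuous_onI)
  have dens: "indicator {a..b} x / emeasure lborel {a..b} = ennreal (indicator {a..b} x / (b - a))" for x
    using ab by (auto simp: indicator_def divide_ennreal simp flip: ennreal_1)
  have "has_bochner_integral lborel (\<lambda>x. indicator {a..b} x *\<^sub>R f x) (F b - F a)"
    using ab F by (intro has_bochner_integral_FTC_Icc continuous_on_subset[OF f]) auto
  from has_bochner_integral_scaleR_right[OF this, of "inverse (b - a)"]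
  have "has_bochner_integral lborel (\<lambda>x. (indicator {a..b} x / (b - a)) *\<^sub>R f x) ((F b - F a) /\<^sub>R (b - a))"
    by (simp add: divide_inverse mult.commute)
  then show ?thesis
    unfolding uniform_measure_def dens
    using ab by (intro has_bochner_integral_density) auto
qed

definition uniform_angle :: "real measure" where
  "uniform_angle = uniform_measure lborel {0..pi}"

lemma prob_space_uniform_angle: "prob_space uniform_angle"
  unfolding uniform_angle_def by (rule prob_space_uniform_measure) auto

interpretation uniform_angle: prob_space uniform_angle
  by (rule prob_space_uniform_angle)

lemma sets_uniform_angle [simp, measurable_cong]: "sets uniform_angle = sets borel"
  by (simp add: uniform_angle_def)

text \<open>
  The function \<open>cos\<^sup>n\<^sup>+\<^sup>1 sin\<close> vanishes at both ends of \<open>[0, \<pi>]\<close>, so its derivative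
  \<open>(n + 2) cos\<^sup>n\<^sup>+\<^sup>2 - (n + 1) cos\<^sup>n\<close> has average 0.
\<close>

lemma cos_moment_rec:
  "(\<integral>\<theta>. cos \<theta> ^ (n + 2) \<partial>uniform_angle) = (n + 1) / (n + 2) * (\<integral>\<theta>. cos \<theta> ^ n \<partial>uniform_angle)"
proof -
  have int: "integrable uniform_angle (\<lambda>\<theta>. cos \<theta> ^ k)" for k
    by (intro uniform_angle.integrable_const_bound[of _ 1])
      (auto simp: power_abs power_le_one)
  have "((\<lambda>\<theta>. cos \<theta> ^ (n + 1) * sin \<theta>) has_vector_derivative
      (n + 2) * cos x ^ (n + 2) - (n + 1) * cos x ^ n) (at x within {0..pi})" for x
  proof -
    have "((\<lambda>\<theta>. cos \<theta> ^ Suc n * sin \<theta>) has_real_derivative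
        real (Suc n) * cos x ^ n * (- sin x) * sin x + cos x ^ Suc n * cos x) (at x within {0..pi})"
      by (auto intro!: derivative_eq_intros simp del: power_Suc)
    also have "real (Suc n) * cos x ^ n * (- sin x) * sin x + cos x ^ Suc n * cos x
        = cos x ^ (n + 2) - (n + 1) * cos x ^ n * (sin x)\<^sup>2"
      by (simp add: power2_eq_square)
    also have "\<dots> = (n + 2) * cos x ^ (n + 2) - (n + 1) * cos x ^ n"
      unfolding sin_squared_eq by (simp add: power_add algebra_simps power2_eq_square)
    finally show ?thesis
      by (simp add: has_real_derivative_iff_has_vector_derivative)
  qed
  moreover have "continuous_on UNIV (\<lambda>\<theta>::real. (n + 2) * cos \<theta> ^ (n + 2) - (n + 1) * cos \<theta> ^ n)"
    by (intro continuous_intros)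
  ultimately have "has_bochner_integral uniform_angle
      (\<lambda>\<theta>. (n + 2) * cos \<theta> ^ (n + 2) - (n + 1) * cos \<theta> ^ n) 0"
    using has_bochner_integral_uniform_FTC[of 0 pi "\<lambda>\<theta>. cos \<theta> ^ (n + 1) * sin \<theta>"
        "\<lambda>\<theta>. (n + 2) * cos \<theta> ^ (n + 2) - (n + 1) * cos \<theta> ^ n"]
    by (simp add: uniform_angle_def del: power_Suc)
  then have "(n + 2) * (\<integral>\<theta>. cos \<theta> ^ (n + 2) \<partial>uniform_angle)
      - (n + 1) * (\<integral>\<theta>. cos \<theta> ^ n \<partial>uniform_angle) = 0"
    using int by (simp add: has_bochner_integral_iff del: power_Suc)
  then show ?thesis
    by (simp add: field_simps)
qed

lemma cos_moment_even:
  "(\<integral>\<theta>. cos \<theta> ^ (2 * k) \<partial>uniform_angle) = fact (2 * k) / (4 ^ k * (fact k)\<^sup>2)"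
proof (induction k)
  case 0
  then show ?case using uniform_angle.prob_space by simp
next
  case (Suc k)
  have "(\<integral>\<theta>. cos \<theta> ^ (2 * Suc k) \<partial>uniform_angle)
      = (2 * k + 1) / (2 * k + 2) * (fact (2 * k) / (4 ^ k * (fact k)\<^sup>2))"
    using cos_moment_rec[of "2 * k"] Suc by (simp add: add.commute del: power_Suc)
  also have "\<dots> = fact (2 * Suc k) / (4 ^ Suc k * (fact (Suc k))\<^sup>2)"
    by (simp add: divide_simps power2_eq_square) (simp add: algebra_simps)
  finally show ?case .
qed

lemma cos_moment_odd: "(\<integral>\<theta>. cos \<theta> ^ Suc (2 * k) \<partial>uniform_angle) = 0"
proof (induction k)
  case 0
  have "has_bochner_integral uniform_angle cos 0"
  proof -
    have "(sin has_vector_derivative cos x) (at x within {0..pi})" for x :: real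
      unfolding has_real_derivative_iff_has_vector_derivative[symmetric]
      by (auto intro!: derivative_eq_intros)
    then show ?thesis
      using has_bochner_integral_uniform_FTC[of 0 pi sin cos]
      by (simp add: uniform_angle_def continuous_on_cos continuous_on_id)
  qed
  then show ?case by (simp add: has_bochner_integral_iff)
next
  case (Suc k)
  then show ?case
    using cos_moment_rec[of "Suc (2 * k)"] by (simp del: power_Suc)
qed

section \<open>The Bessel functions as angular averages\<close>

text \<open>
  Termwise integration of the exponential series, dominated by that of \<open>exp |x|\<close>.
\<close>

lemma exp_cos_average_sums:
  "(\<lambda>n. x ^ n / fact n * (\<integral>\<theta>. cos \<theta> ^ (n + j) \<partial>uniform_angle))
     sums (\<integral>\<theta>. exp (x * cos \<theta>) * cos \<theta> ^ j \<partial>uniform_angle)"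
proof -
  let ?f = "\<lambda>n \<theta>. x ^ n / fact n * cos \<theta> ^ (n + j)"
  have int: "integrable uniform_angle (?f n)" for n
    by (intro integrable_mult_right uniform_angle.integrable_const_bound[of _ 1])
      (auto simp: power_abs power_le_one)
  have le: "norm (?f n \<theta>) \<le> \<bar>x\<bar> ^ n / fact n" for n \<theta>
    by (simp add: abs_mult power_abs power_le_one mult_left_le divide_right_mono)
  have exp_summable: "summable (\<lambda>n. \<bar>x\<bar> ^ n / fact n)"
    using summable_exp[of "\<bar>x\<bar>"] by (simp add: divide_inverse mult.commute)
  have "(\<lambda>n. integral\<^sup>L uniform_angle (?f n)) sums (\<integral>\<theta>. (\<Sum>n. ?f n \<theta>) \<partial>uniform_angle)"
  proof (rule sums_integral[OF int])
    show "AE \<theta> in uniform_angle. summable (\<lambda>n. norm (?f n \<theta>))"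
      by (intro AE_I2 summable_comparison_test'[OF exp_summable]) (use le in auto)
    have "(\<integral>\<theta>. norm (?f n \<theta>) \<partial>uniform_angle) \<le> \<bar>x\<bar> ^ n / fact n" for n
      using le by (intro uniform_angle.integral_le_const integrable_norm int AE_I2)
    then show "summable (\<lambda>n. \<integral>\<theta>. norm (?f n \<theta>) \<partial>uniform_angle)"
      by (intro summable_comparison_test'[OF exp_summable]) simp
  qed
  moreover have "(\<Sum>n. ?f n \<theta>) = exp (x * cos \<theta>) * cos \<theta> ^ j" for \<theta>
  proof -
    have "(\<lambda>n. (x * cos \<theta>) ^ n /\<^sub>R fact n * cos \<theta> ^ j) sums (exp (x * cos \<theta>) * cos \<theta> ^ j)"
      by (intro sums_mult2 exp_converges)
    then show ?thesis
      by (simp add: sums_iff power_mult_distrib power_add divide_inverse mult_ac)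
  qed
  ultimately show ?thesis by simp
qed

text \<open>
  Only the even moments of the cosine survive, and the factorials \<open>(2k)!\<close> of the moment and of the
  exponential series cancel, which leaves the series of \<open>I\<^sub>0\<close>.
\<close>

lemma bessel_I_0_eq_average:
  assumes "0 < x"
  shows "bessel_I 0 x = (\<integral>\<theta>. exp (x * cos \<theta>) \<partial>uniform_angle)"
proof -
  let ?f = "\<lambda>n. x ^ n / fact n * (\<integral>\<theta>. cos \<theta> ^ (n + 0) \<partial>uniform_angle)"
  have "(\<lambda>k. ?f (2 * k)) sums (\<integral>\<theta>. exp (x * cos \<theta>) * cos \<theta> ^ 0 \<partial>uniform_angle)"
  proof (subst sums_mono_reindex)
    show "?f n = 0" if "n \<notin> range ((*) 2)" for n
      using that cos_moment_odd[of "n div 2"] by (cases "even n") (auto elim!: evenE oddE)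
  qed (use exp_cos_average_sums[of x 0] in \<open>auto simp: strict_mono_def\<close>)
  moreover have "?f (2 * k) = (x / 2) ^ (0 + 2 * k) / (fact k * fact (0 + k))" for k
    using cos_moment_even[of k]
    by (simp add: power_divide power_mult power2_eq_square)
  ultimately show ?thesis
    using bessel_I_of_nat[OF assms, of 0] by (simp add: sums_iff)
qed

lemma bessel_I_1_eq_average:
  assumes "0 < x"
  shows "bessel_I 1 x = (\<integral>\<theta>. exp (x * cos \<theta>) * cos \<theta> \<partial>uniform_angle)"
proof -
  let ?f = "\<lambda>n. x ^ n / fact n * (\<integral>\<theta>. cos \<theta> ^ (n + 1) \<partial>uniform_angle)"
  have "(\<lambda>k. ?f (Suc (2 * k))) sums (\<integral>\<theta>. exp (x * cos \<theta>) * cos \<theta> ^ 1 \<partial>uniform_angle)"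
  proof (subst sums_mono_reindex)
    show "?f n = 0" if "n \<notin> range (\<lambda>k. Suc (2 * k))" for n
      using that cos_moment_odd[of "n div 2"] by (cases "even n") (auto elim!: evenE oddE)
  qed (use exp_cos_average_sums[of x 1] in \<open>auto simp: strict_mono_def\<close>)
  moreover have "?f (Suc (2 * k)) = (x / 2) ^ (1 + 2 * k) / (fact k * fact (1 + k))" for k
  proof -
    have "?f (Suc (2 * k)) = x ^ Suc (2 * k) / fact (Suc (2 * k))
        * (fact (2 * Suc k) / (4 ^ Suc k * (fact (Suc k))\<^sup>2))"
      using cos_moment_even[of "Suc k"] by (simp del: fact_Suc power_Suc)
    also have "\<dots> = (x / 2) ^ (1 + 2 * k) / (fact k * fact (1 + k))"
      by (simp add: power_divide power_mult power2_eq_square divide_simps)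
    finally show ?thesis .
  qed
  ultimately show ?thesis
    using bessel_I_of_nat[OF assms, of 1] by (simp add: sums_iff)
qed

lemma bessel_density_eq_mixture:
  assumes "0 < x"
  shows "exp (- x) * (bessel_I 0 x - bessel_I 1 x)
    = (\<integral>\<theta>. (1 - cos \<theta>) * exp (- ((1 - cos \<theta>) * x)) \<partial>uniform_angle)"
proof -
  have le: "exp (x * cos \<theta>) \<le> exp x" for \<theta>
    using assms by simp
  have le': "exp (x * cos \<theta>) * \<bar>cos \<theta>\<bar> \<le> exp x" for \<theta>
    using mult_mono[OF le[of \<theta>] abs_cos_le_one[of \<theta>]] by simp
  have "integrable uniform_angle (\<lambda>\<theta>. exp (x * cos \<theta>))"
    "integrable uniform_angle (\<lambda>\<theta>. exp (x * cos \<theta>) * cos \<theta>)"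
    using le le'
    by (intro uniform_angle.integrable_const_bound[of _ "exp x"]; simp add: abs_mult)+
  then have "exp (- x) * (bessel_I 0 x - bessel_I 1 x)
    = (\<integral>\<theta>. exp (- x) * (exp (x * cos \<theta>) - exp (x * cos \<theta>) * cos \<theta>) \<partial>uniform_angle)"
    by (simp add: bessel_I_0_eq_average bessel_I_1_eq_average assms)
  also have "\<dots> = (\<integral>\<theta>. (1 - cos \<theta>) * exp (- ((1 - cos \<theta>) * x)) \<partial>uniform_angle)"
    by (intro Bochner_Integration.integral_cong refl) (simp add: algebra_simps exp_diff exp_minus exp_add field_simps)
  finally show ?thesis .
qed

section \<open>The Poisson kernel\<close>

text \<open>
  The kernel splits as \<open>1 + \<rho>z / (1 - \<rho>z) + \<rho>z' / (1 - \<rho>z')\<close> with \<open>z = exp (i\<theta>)\<close> and \<open>z' = exp (- i\<theta>)\<close>,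
  and has the primitive \<open>\<theta> + i Ln (1 - \<rho>z) - i Ln (1 - \<rho>z')\<close>. As \<open>|\<rho>| < 1\<close>, the arguments of the
  logarithms stay in the right half-plane. The logarithms cancel at both ends, where
  \<open>z = z'\<close>, so the integral over \<open>[0, \<pi>]\<close> is \<open>\<pi>\<close>.
\<close>

lemma poisson_kernel_average:
  fixes \<rho> :: complex
  assumes \<rho>: "norm \<rho> < 1"
  shows "has_bochner_integral uniform_angle
    (\<lambda>\<theta>. (1 - \<rho>\<^sup>2) / (1 - 2 * \<rho> * of_real (cos \<theta>) + \<rho>\<^sup>2)) 1"
proof -
  let ?e = "\<lambda>\<theta>::real. exp (\<i> * of_real \<theta>)"
  let ?e' = "\<lambda>\<theta>::real. exp (- (\<i> * of_real \<theta>))"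
  let ?F = "\<lambda>\<theta>. of_real \<theta> + \<i> * Ln (1 - \<rho> * ?e \<theta>) - \<i> * Ln (1 - \<rho> * ?e' \<theta>)"
  let ?f = "\<lambda>\<theta>. (1 - \<rho>\<^sup>2) / (1 - 2 * \<rho> * of_real (cos \<theta>) + \<rho>\<^sup>2)"
  have Re_pos: "0 < Re (1 - \<rho> * z)" if "norm z = 1" for z
    using complex_Re_le_cmod[of "\<rho> * z"] \<rho> that by (simp add: norm_mult)
  then have slit: "1 - \<rho> * z \<notin> \<real>\<^sub>\<le>\<^sub>0" if "norm z = 1" for z
    using that by (force simp: complex_nonpos_Reals_iff)
  then have nz: "1 - \<rho> * z \<noteq> 0" if "norm z = 1" for z
    using that by fastforce
  have norm_e: "norm (?e \<theta>) = 1" "norm (?e' \<theta>) = 1" for \<theta>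
    by simp_all
  have factor: "1 - 2 * \<rho> * of_real (cos \<theta>) + \<rho>\<^sup>2 = (1 - \<rho> * ?e \<theta>) * (1 - \<rho> * ?e' \<theta>)" for \<theta>
  proof -
    have "2 * of_real (cos \<theta>) = ?e \<theta> + ?e' \<theta>"
      by (simp add: cos_of_real [symmetric] cos_exp_eq)
    moreover have "?e \<theta> * ?e' \<theta> = 1"
      by (simp add: exp_minus)
    ultimately show ?thesis
      by algebra
  qed
  have "(?F has_vector_derivative ?f \<theta>) (at \<theta> within {0..pi})" for \<theta>
  proof -
    have nz1: "1 - \<rho> * ?e \<theta> \<noteq> 0" and nz2: "1 - \<rho> * ?e' \<theta> \<noteq> 0"
      by (rule nz norm_e)+
    have "((\<lambda>w. w + \<i> * Ln (1 - \<rho> * exp (\<i> * w)) - \<i> * Ln (1 - \<rho> * exp (- (\<i> * w))))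
        has_field_derivative 1 + \<i> * ((- \<rho> * \<i> * ?e \<theta>) / (1 - \<rho> * ?e \<theta>))
          - \<i> * ((\<rho> * \<i> * ?e' \<theta>) / (1 - \<rho> * ?e' \<theta>))) (at (of_real \<theta>))"
      using slit[OF norm_e(1)] slit[OF norm_e(2)] nz1 nz2
      by (auto intro!: derivative_eq_intros simp: field_simps)
    also have "1 + \<i> * ((- \<rho> * \<i> * ?e \<theta>) / (1 - \<rho> * ?e \<theta>))
          - \<i> * ((\<rho> * \<i> * ?e' \<theta>) / (1 - \<rho> * ?e' \<theta>))
        = 1 + \<rho> * ?e \<theta> / (1 - \<rho> * ?e \<theta>) + \<rho> * ?e' \<theta> / (1 - \<rho> * ?e' \<theta>)"
      by (simp add: mult_ac)
    also have "\<dots> = ?f \<theta>"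
    proof -
      have "?e \<theta> * ?e' \<theta> = 1"
        by (simp add: exp_minus)
      then have "(1 - \<rho> * ?e \<theta>) * (1 - \<rho> * ?e' \<theta>) + \<rho> * ?e \<theta> * (1 - \<rho> * ?e' \<theta>)
          + \<rho> * ?e' \<theta> * (1 - \<rho> * ?e \<theta>) = 1 - \<rho>\<^sup>2"
        by algebra
      moreover have "1 + x / A + y / B = (A * B + x * B + y * A) / (A * B)"
        if "A \<noteq> 0" "B \<noteq> 0" for A B x y :: complex
        using that by (simp add: field_simps)
      ultimately show ?thesis
        unfolding factor using nz1 nz2 by simp
    qed
    finally show ?thesis
      by (intro has_vector_derivative_real_field)
  qed
  moreover have "continuous_on UNIV ?f"
    using nz[OF norm_e(1)] nz[OF norm_e(2)] by (intro continuous_intros) (simp add: factor)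
  ultimately have "has_bochner_integral uniform_angle ?f ((?F pi - ?F 0) /\<^sub>R (pi - 0))"
    unfolding uniform_angle_def by (intro has_bochner_integral_uniform_FTC) auto
  then show ?thesis
    by (simp add: exp_minus scaleR_conv_of_real)
qed

text \<open>
  The condition \<open>Re (s w\<^sup>*) > 0\<close>, with \<open>w\<^sup>*\<close> the conjugate, selects the root \<open>w\<close> of \<open>s\<^sup>2 - 1\<close>: it means
  \<open>|s - w| < |s + w|\<close>, and since the product of these two numbers is 1, the parameter \<open>\<rho> = s - w\<close>
  of the Poisson kernel lies in the unit disc.
\<close>

lemma average_inverse_minus_cos:
  fixes s w :: complex
  assumes w2: "w\<^sup>2 = s\<^sup>2 - 1" and pos: "0 < Re (s * cnj w)"
  shows "has_bochner_integral uniform_angle (\<lambda>\<theta>. 1 / (s - of_real (cos \<theta>))) (1 / w)"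
proof -
  let ?\<rho> = "s - w"
  have inv: "(s - w) * (s + w) = 1"
    using w2 by algebra
  have w: "w \<noteq> 0"
    using pos by auto
  have \<rho>: "?\<rho> \<noteq> 0"
    using inv by auto
  have "(norm (s - w))\<^sup>2 < (norm (s + w))\<^sup>2"
    using pos unfolding cmod_power2 by (simp add: power2_eq_square algebra_simps)
  then have "norm (s - w) < norm (s + w)"
    by (rule power2_less_imp_less) simp
  moreover have "norm ?\<rho> * norm (s + w) = 1"
    using inv by (simp flip: norm_mult)
  ultimately have "(norm ?\<rho>)\<^sup>2 < 1\<^sup>2"
    using mult_strict_left_mono[of "norm ?\<rho>" "norm (s + w)" "norm ?\<rho>"] \<rho>
    by (simp add: power2_eq_square)
  then have "norm ?\<rho> < 1"
    by (rule power2_less_imp_less) simp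
  from has_bochner_integral_mult_right[OF poisson_kernel_average[OF this], of "1 / w"]
  have "has_bochner_integral uniform_angle
      (\<lambda>\<theta>. 1 / w * ((1 - ?\<rho>\<^sup>2) / (1 - 2 * ?\<rho> * of_real (cos \<theta>) + ?\<rho>\<^sup>2))) (1 / w)"
    by simp
  moreover have "1 / w * ((1 - ?\<rho>\<^sup>2) / (1 - 2 * ?\<rho> * of_real (cos \<theta>) + ?\<rho>\<^sup>2))
      = 1 / (s - of_real (cos \<theta>))" for \<theta>
  proof -
    have "1 - ?\<rho>\<^sup>2 = 2 * ?\<rho> * w"
      using inv by algebra
    moreover have "1 - 2 * ?\<rho> * of_real (cos \<theta>) + ?\<rho>\<^sup>2 = 2 * ?\<rho> * (s - of_real (cos \<theta>))"
      using inv by algebra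
    ultimately show ?thesis
      using w \<rho> by simp
  qed
  ultimately show ?thesis by simp
qed

section \<open>The Bessel law\<close>

lemma bessel_measure_eq_mixture:
  "bessel_measure = exponential_mixture uniform_angle (\<lambda>\<theta>. 1 - cos \<theta>)"
proof -
  have "exp (- x) * (bessel_I 0 x - bessel_I 1 x) * indicator {0<..} x
      = (\<integral>\<theta>. expo_density (1 - cos \<theta>) x \<partial>uniform_angle)" for x
    by (cases "0 < x") (simp_all add: bessel_density_eq_mixture)
  then show ?thesis
    by (simp only: bessel_measure_def exponential_mixture_def)
qed

lemma AE_uniform_angle_pos: "AE \<theta> in uniform_angle. 0 < 1 - cos \<theta>"
proof -
  have "0 < 1 - cos \<theta>" if "\<theta> \<noteq> 0" "\<theta> \<in> {0..pi}" for \<theta>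
    using that cos_monotone_0_pi[of 0 \<theta>] by auto
  moreover have "AE \<theta> in lborel. \<theta> \<noteq> (0::real)"
    by (rule AE_lborel_singleton)
  ultimately show ?thesis
    unfolding uniform_angle_def by (intro AE_uniform_measureI) auto
qed

lemma real_distribution_bessel_measure: "real_distribution bessel_measure"
  unfolding bessel_measure_eq_mixture
  by (intro real_distribution_exponential_mixture prob_space_uniform_angle AE_uniform_angle_pos)
    measurable

lemma AE_bessel_measure_pos: "AE x in bessel_measure. 0 < x"
  unfolding bessel_measure_eq_mixture
  by (intro AE_exponential_mixture_pos prob_space_uniform_angle AE_uniform_angle_pos) measurable

text \<open>
  Comparing imaginary parts in \<open>w\<^sup>2 = - t (t + 2i)\<close> gives \<open>Re w Im w = - t\<close>; therefore the real part of
  \<open>(1 - it) w\<^sup>*\<close> is \<open>Re w (1 + (Im w)\<^sup>2)\<close>, which is positive for the principal root as \<open>t \<noteq> 0\<close>.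
\<close>

lemma csqrt_bessel_branch:
  fixes t :: real
  assumes "t \<noteq> 0"
  defines "s \<equiv> 1 - \<i> * of_real t"
  defines "w \<equiv> csqrt (- (of_real t) * (of_real t + 2 * \<i>))"
  shows "w\<^sup>2 = s\<^sup>2 - 1" "0 < Re (s * cnj w)"
proof -
  have w2: "w\<^sup>2 = - (of_real t) * (of_real t + 2 * \<i>)"
    by (simp add: w_def)
  then show "w\<^sup>2 = s\<^sup>2 - 1"
    by (simp add: s_def power2_eq_square algebra_simps)
  from w2 have Im_w2: "Re w * Im w = - t"
    by (simp add: complex_eq_iff power2_eq_square mult.commute)
  moreover have "0 \<le> Re w"
    unfolding w_def by (rule Re_csqrt)
  ultimately have "0 < Re w"
    using assms(1) by (cases "Re w = 0") auto
  moreover have "Re (s * cnj w) = Re w * (1 + (Im w)\<^sup>2)"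
    using Im_w2 by (simp add: s_def power2_eq_square algebra_simps)
  ultimately show "0 < Re (s * cnj w)"
    by (simp add: add_pos_nonneg)
qed

lemma char_bessel_measure: "char bessel_measure t = 1 + bessel_exponent t"
proof (cases "t = 0")
  case True
  interpret real_distribution bessel_measure
    by (rule real_distribution_bessel_measure)
  show ?thesis
    using True by (simp add: char_zero bessel_exponent_def)
next
  case False
  let ?s = "1 - \<i> * of_real t"
  let ?w = "csqrt (- (of_real t) * (of_real t + 2 * \<i>))"
  have int: "has_bochner_integral uniform_angle (\<lambda>\<theta>. 1 / (?s - of_real (cos \<theta>))) (1 / ?w)"
    using False by (intro average_inverse_minus_cos csqrt_bessel_branch)
  have "char bessel_measure t
      = (\<integral>\<theta>. of_real (1 - cos \<theta>) / (of_real (1 - cos \<theta>) - \<i> * of_real t) \<partial>uniform_angle)"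
    unfolding bessel_measure_eq_mixture
    by (intro char_exponential_mixture prob_space_uniform_angle AE_uniform_angle_pos) measurable
  also have "\<dots> = (\<integral>\<theta>. 1 + \<i> * of_real t * (1 / (?s - of_real (cos \<theta>))) \<partial>uniform_angle)"
  proof (intro Bochner_Integration.integral_cong refl)
    fix \<theta>
    have "?s - of_real (cos \<theta>) \<noteq> 0"
      using False by (auto simp: complex_eq_iff)
    then show "of_real (1 - cos \<theta>) / (of_real (1 - cos \<theta>) - \<i> * of_real t)
        = 1 + \<i> * of_real t * (1 / (?s - of_real (cos \<theta>)))"
      by (simp add: divide_simps)
  qed
  also have "\<dots> = 1 + \<i> * of_real t * (1 / ?w)"
  proof -
    have "has_bochner_integral uniform_angle (\<lambda>_. 1::complex) 1"
      using uniform_angle.prob_space by (simp add: has_bochner_integral_iff)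
    from has_bochner_integral_add[OF this has_bochner_integral_mult_right[OF int, of "\<i> * of_real t"]]
    show ?thesis
      by (rule has_bochner_integral_integral_eq)
  qed
  finally show ?thesis
    using False by (simp add: bessel_exponent_def)
qed

lemma integral_iexp_minus_1_bessel_measure:
  "(CLINT x:{0<..}|bessel_measure. iexp (t * x) - 1) = bessel_exponent t"
proof -
  interpret real_distribution bessel_measure
    by (rule real_distribution_bessel_measure)
  have "AE x in bessel_measure. x \<in> {0<..}"
    using AE_bessel_measure_pos by simp
  then have "(CLINT x:{0<..}|bessel_measure. iexp (t * x) - 1)
      = (CLINT x|bessel_measure. iexp (t * x) - 1)"
    unfolding set_lebesgue_integral_def
    by (intro integral_cong_AE) (auto elim!: eventually_mono)
  also have "\<dots> = char bessel_measure t - 1"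
    unfolding char_def using prob_space
    by (subst Bochner_Integration.integral_diff) (auto intro!: integrable_iexp)
  finally show ?thesis
    by (simp add: char_bessel_measure)
qed

lemma continuous_bessel_exponent: "continuous_on UNIV bessel_exponent"
proof -
  interpret real_distribution bessel_measure
    by (rule real_distribution_bessel_measure)
  have "bessel_exponent = (\<lambda>t. char bessel_measure t - 1)"
    by (simp add: char_bessel_measure)
  moreover have "isCont (\<lambda>t. char bessel_measure t - 1) t" for t
    by (intro continuous_intros isCont_char)
  ultimately show ?thesis
    by (simp add: continuous_at_imp_continuous_on)
qed

lemma measure_bessel_measure_zero: "measure bessel_measure {0} = 0"
proof -
  interpret real_distribution bessel_measure
    by (rule real_distribution_bessel_measure)
  show ?thesis
    by (subst prob_eq_0) (use AE_bessel_measure_pos in \<open>auto elim!: eventually_mono\<close>)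
qed

theorem corollary6:
  shows "(\<forall>x>0. 0 \<le> exp (- x) * (bessel_I 0 x - bessel_I 1 x)) \<and>
    prob_space bessel_measure \<and>
    (\<forall>t::real. (CLINT x:{0<..}|bessel_measure. iexp (t * x) - 1) = bessel_exponent t) \<and>
    (bessel_exponent \<longlongrightarrow> 0) (at 0) \<and>
    (\<exists>M. infinitely_divisible M \<and> is_compound_poisson M \<and>
       is_log_char (\<lambda>t. CLINT x:{0<..}|bessel_measure. iexp (t * x) - 1) M) \<and>
    (\<exists>M. infinitely_divisible M \<and> is_compound_poisson M \<and> is_log_char bessel_exponent M)"
proof (intro conjI)
  let ?M = "compound_poisson 1 bessel_measure"
  interpret B: real_distribution bessel_measure
    by (rule real_distribution_bessel_measure)
  show "\<forall>x>0. 0 \<le> exp (- x) * (bessel_I 0 x - bessel_I 1 x)"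
    by (auto simp: bessel_density_eq_mixture intro!: integral_nonneg_AE)
  show "prob_space bessel_measure"
    by (rule B.prob_space_axioms)
  show exponent: "\<forall>t::real. (CLINT x:{0<..}|bessel_measure. iexp (t * x) - 1) = bessel_exponent t"
    by (simp add: integral_iexp_minus_1_bessel_measure del: of_real_mult)
  have zero: "bessel_exponent 0 = 0"
    by (simp add: bessel_exponent_def)
  show "(bessel_exponent \<longlongrightarrow> 0) (at 0)"
    using continuous_bessel_exponent zero
    by (metis continuous_on_def UNIV_I)
  have M: "infinitely_divisible ?M \<and> is_compound_poisson ?M \<and> is_log_char bessel_exponent ?M"
    unfolding is_compound_poisson_def is_log_char_def
    using real_distribution_bessel_measure measure_bessel_measure_zero continuous_bessel_exponent zero
    by (auto intro!: infinitely_divisible_compound_poisson exI[of _ 1]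
        simp: char_compound_poisson char_bessel_measure)
  then show "\<exists>M. infinitely_divisible M \<and> is_compound_poisson M \<and> is_log_char bessel_exponent M"
    by blast
  have "(\<lambda>t. CLINT x:{0<..}|bessel_measure. iexp (t * x) - 1) = bessel_exponent"
    using exponent by blast
  with M show "\<exists>M. infinitely_divisible M \<and> is_compound_poisson M \<and>
       is_log_char (\<lambda>t. CLINT x:{0<..}|bessel_measure. iexp (t * x) - 1) M"
    by metis
qed

end
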